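(* Let $s$ and $t$ be integers with $4 \leq s \leq t$. Let $G$ be a multigraph and let $L(G)$ denote its line graph. If $\chi(L(G)) = s+t-1 > \omega(L(G))$, then $L(G)$ contains a clique $Q$ of size $s$ such that $\chi(L(G) - Q) \geq t + 1$.
   Context: A multigraph may have multiple edges between the same pair of vertices. The line graph $L(G)$ of a multigraph $G$ has vertex set $E(G)$, two distinct edges being adjacent in $L(G)$ if and only if they share at least one endpoint. $\chi(H)$ denotes the chromatic number and $\omega(H)$ the clique number (size of a largest clique) of a graph $H$; $L(G)-Q$ denotes the graph obtained from $L(G)$ by deleting the vertices of $Q$. *)

theory Defs
  imports Main "HOL-Library.Ramsey"
begin

text \<open>A simple graph is a pair of a vertex set and a set of two-element sets of vertices. This matches
  the convention of \<^const>\<open>clique\<close> in \<^theory>\<open>HOL-Library.Ramsey\<close>.\<close>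

type_synonym 'a sgraph = "'a set \<times> 'a set set"

definition delete_vertices :: "'a sgraph \<Rightarrow> 'a set \<Rightarrow> 'a sgraph" where
  "delete_vertices H Q = (fst H - Q, {e \<in> snd H. e \<inter> Q = {}})"

definition is_clique :: "'a sgraph \<Rightarrow> 'a set \<Rightarrow> bool" where
  "is_clique H Q \<longleftrightarrow> Q \<subseteq> fst H \<and> clique Q (snd H)"

definition clique_number :: "'a sgraph \<Rightarrow> nat" where
  "clique_number H = Max {card Q | Q. is_clique H Q}"

definition proper_colouring :: "'a sgraph \<Rightarrow> nat \<Rightarrow> ('a \<Rightarrow> nat) \<Rightarrow> bool" where
  "proper_colouring H k c \<longleftrightarrow>
     (\<forall>v \<in> fst H. c v < k) \<and>
     (\<forall>u \<in> fst H. \<forall>v \<in> fst H. {u, v} \<in> snd H \<longrightarrow> c u \<noteq> c v)"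

definition chromatic_number :: "'a sgraph \<Rightarrow> nat" where
  "chromatic_number H = (LEAST k. \<exists>c. proper_colouring H k c)"

text \<open>Multigraphs are finite and loopless. Edges are abstract objects, so that parallel edges are
  distinct edges with the same set of endpoints.\<close>

record ('v, 'e) multigraph =
  vertices :: "'v set"
  edges :: "'e set"
  ends :: "'e \<Rightarrow> 'v set"

definition is_multigraph :: "('v, 'e) multigraph \<Rightarrow> bool" where
  "is_multigraph G \<longleftrightarrow>
     finite (vertices G) \<and> finite (edges G) \<and>
     (\<forall>e \<in> edges G. ends G e \<subseteq> vertices G \<and> card (ends G e) = 2)"

definition line_graph :: "('v, 'e) multigraph \<Rightarrow> 'e sgraph" where
  "line_graph G =
     (edges G,
      {{e, f} | e f. e \<in> edges G \<and> f \<in> edges G \<and> e \<noteq> f \<and> ends G e \<inter> ends G f \<noteq> {}})"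

end

theory Submission
  imports Defs
begin

text \<open>Let \<open>k = s + t - 2\<close>. Assume that \<open>G - Q\<close> is \<open>t\<close>-edge-colourable for every \<open>s\<close>-clique \<open>Q\<close>, and
  pass to a minimal subgraph that is not \<open>k\<close>-edge-colourable. Let \<open>Q\<close> consist of \<open>s\<close> edges at a
  vertex \<open>x\<close>. In a \<open>t\<close>-colouring of \<open>G - Q\<close> at least two colours are missing at \<open>x\<close>, and a Kempe-type
  exchange lets one new colour serve two edges \<open>xu\<close>, \<open>xv\<close> of \<open>Q\<close> unless the missing colour
  occurs on an edge \<open>uv\<close>. Two such exchanges would colour \<open>G\<close> with \<open>k\<close> colours, so the missing colours
  are concentrated on few edges between neighbours of \<open>x\<close>. It follows that a vertex of degree at least \<open>s\<close> has
  exactly three neighbours, two pairs of which are joined by many edges. On the other hand, if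
  \<open>deg x > t\<close>, removing \<open>s\<close> edges at another vertex must bring the degree of \<open>x\<close> down to \<open>t\<close>,
  which bounds the number of edges meeting two vertices of large degree. Together these conditions
  force a component with four vertices, which is coloured with as many colours as its largest
  clique has edges, by letting opposite edges share colours.\<close>

section \<open>Edge colourings of families of edges\<close>

text \<open>The family \<open>F\<close> is kept apart from the endpoint map \<open>en\<close>, so
  that subfamilies can be coloured without rebuilding a multigraph.\<close>

definition edge_colouring :: "('e \<Rightarrow> 'v set) \<Rightarrow> 'e set \<Rightarrow> nat \<Rightarrow> ('e \<Rightarrow> nat) \<Rightarrow> bool" where
  "edge_colouring en F n c \<longleftrightarrow>
     (\<forall>e\<in>F. c e < n) \<and> (\<forall>e\<in>F. \<forall>f\<in>F. e \<noteq> f \<longrightarrow> en e \<inter> en f \<noteq> {} \<longrightarrow> c e \<noteq> c f)"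

definition edge_colourable :: "('e \<Rightarrow> 'v set) \<Rightarrow> 'e set \<Rightarrow> nat \<Rightarrow> bool" where
  "edge_colourable en F n \<longleftrightarrow> (\<exists>c. edge_colouring en F n c)"

definition intersecting :: "('e \<Rightarrow> 'v set) \<Rightarrow> 'e set \<Rightarrow> bool" where
  "intersecting en Q \<longleftrightarrow> (\<forall>e\<in>Q. \<forall>f\<in>Q. e \<noteq> f \<longrightarrow> en e \<inter> en f \<noteq> {})"

lemma edge_colouringD:
  assumes "edge_colouring en F n c"
  shows "e \<in> F \<Longrightarrow> c e < n"
    and "e \<in> F \<Longrightarrow> f \<in> F \<Longrightarrow> v \<in> en e \<Longrightarrow> v \<in> en f \<Longrightarrow> c e = c f \<Longrightarrow> e = f"
  using assms unfolding edge_colouring_def by blast+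

lemma edge_colourable_mono:
  assumes "edge_colourable en F n" "F' \<subseteq> F" "n \<le> n'"
  shows "edge_colourable en F' n'"
proof -
  obtain c where "edge_colouring en F n c"
    using assms(1) unfolding edge_colourable_def by blast
  then have "edge_colouring en F' n' c"
    using assms(2,3) unfolding edge_colouring_def by (meson subsetD order_less_le_trans)
  then show ?thesis unfolding edge_colourable_def by blast
qed

lemma edge_colourable_card:
  assumes "finite R"
  shows "edge_colourable en R (card R)"
proof -
  obtain h where "bij_betw h R {0..<card R}"
    using ex_bij_betw_finite_nat[OF assms] by blast
  then have "edge_colouring en R (card R) h"
    unfolding edge_colouring_def by (auto simp: bij_betw_def inj_on_def)
  then show ?thesis unfolding edge_colourable_def by blast
qed

text \<open>Shifting the colours of \<open>R\<close> by \<open>n\<close> makes the two palettes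
  disjoint, so edges of \<open>F\<close> and \<open>R\<close> may meet freely. An edge in both takes
  its colour from \<open>R\<close>.\<close>

lemma edge_colourable_Un:
  assumes "edge_colourable en F n" "edge_colourable en R m"
  shows "edge_colourable en (F \<union> R) (n + m)"
proof -
  obtain c where c: "edge_colouring en F n c"
    using assms(1) unfolding edge_colourable_def by blast
  obtain h where h: "edge_colouring en R m h"
    using assms(2) unfolding edge_colourable_def by blast
  define c' where "c' e = (if e \<in> R then n + h e else c e)" for e
  have "edge_colouring en (F \<union> R) (n + m) c'"
    unfolding edge_colouring_def
  proof (intro conjI ballI impI)
    fix e assume "e \<in> F \<union> R"
    then show "c' e < n + m"
      using edge_colouringD(1)[OF h, of e] edge_colouringD(1)[OF c, of e] by (auto simp: c'_def)
  next
    fix e f assume ef: "e \<in> F \<union> R" "f \<in> F \<union> R" "e \<noteq> f" "en e \<inter> en f \<noteq> {}"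
    then show "c' e \<noteq> c' f"
      using edge_colouringD(1)[OF c, of e] edge_colouringD(1)[OF c, of f] c h
      unfolding edge_colouring_def by (auto simp: c'_def)
  qed
  then show ?thesis unfolding edge_colourable_def by blast
qed

lemma edge_colourable_disjoint_Un:
  assumes "edge_colourable en A n" "edge_colourable en B n"
    and "\<And>e f. e \<in> A \<Longrightarrow> f \<in> B \<Longrightarrow> en e \<inter> en f = {}"
  shows "edge_colourable en (A \<union> B) n"
proof -
  obtain c where c: "edge_colouring en A n c"
    using assms(1) unfolding edge_colourable_def by blast
  obtain c' where c': "edge_colouring en B n c'"
    using assms(2) unfolding edge_colourable_def by blast
  have "edge_colouring en (A \<union> B) n (\<lambda>e. if e \<in> A then c e else c' e)"
    using c c' assms(3) unfolding edge_colouring_def by (smt (verit) Int_commute Un_iff)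
  then show ?thesis unfolding edge_colourable_def by blast
qed

lemma two_le_card_obtain:
  assumes "2 \<le> card A"
  obtains a b where "a \<in> A" "b \<in> A" "a \<noteq> b"
proof -
  obtain B where "B \<subseteq> A" "card B = 2" using obtain_subset_with_card_n[OF assms] by blast
  then show thesis using that by (auto simp: card_2_iff)
qed

text \<open>Kempe-type step at \<open>x\<close>: the edge \<open>f = xu\<close> receives the colour \<open>\<gamma>\<close> missing at \<open>x\<close>, the edge
  of colour \<open>\<gamma>\<close> at \<open>u\<close> (if any) moves to the new colour \<open>n\<close>, and \<open>n\<close> is then still available for
  \<open>g = xv\<close>. Thus one new colour serves two uncoloured edges.\<close>

lemma edge_colouring_pair_extension:
  assumes c: "edge_colouring en F n c"
    and f: "f \<notin> F" "en f = {x, u}" and g: "g \<notin> F" "en g = {x, v}"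
    and neq: "u \<noteq> v"
    and gam: "\<gamma> < n" "\<And>e. e \<in> F \<Longrightarrow> x \<in> en e \<Longrightarrow> c e \<noteq> \<gamma>"
    and nouv: "\<And>e. e \<in> F \<Longrightarrow> u \<in> en e \<Longrightarrow> v \<in> en e \<Longrightarrow> c e \<noteq> \<gamma>"
  obtains c' where "edge_colouring en (F \<union> {f, g}) (Suc n) c'"
    "c' f = \<gamma>" "c' g = n" "\<And>e. e \<in> F \<Longrightarrow> c' e = c e \<or> (c e = \<gamma> \<and> c' e = n)"
proof -
  have fg: "f \<noteq> g" using f g neq by (auto simp: doubleton_eq_iff)
  define c' where "c' e = (if e = f then \<gamma> else if e = g then n
      else if u \<in> en e \<and> c e = \<gamma> then n else c e)" for e
  have F1: "c' e = (if u \<in> en e \<and> c e = \<gamma> then n else c e)" if "e \<in> F" for e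
    using that f g by (auto simp: c'_def)
  have F2: "c' f = \<gamma>" "c' g = n" using fg by (auto simp: c'_def)
  have lt: "c e < n" if "e \<in> F" for e using edge_colouringD(1)[OF c that] .
  have fF: "c' f \<noteq> c' e" if "e \<in> F" "en f \<inter> en e \<noteq> {}" for e
    using that f gam(1) gam(2)[of e] F1[of e] F2 by auto
  \<comment> \<open>An edge moved to \<open>n\<close> contains \<open>u\<close>; it avoids
    \<open>x\<close> by \<open>gam\<close> and \<open>v\<close> by \<open>nouv\<close>, so it does
    not meet \<open>g\<close>.\<close>
  have gF: "c' g \<noteq> c' e" if "e \<in> F" "en g \<inter> en e \<noteq> {}" for e
    using that g gam(2)[of e] nouv[of e] F1[of e] F2 lt[of e] by auto
  have FF: "c' e \<noteq> c' e'" if "e \<in> F" "e' \<in> F" "e \<noteq> e'" "en e \<inter> en e' \<noteq> {}" for e e'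
  proof -
    have "c e \<noteq> c e'" using c that unfolding edge_colouring_def by blast
    moreover have "\<not> (u \<in> en e \<and> u \<in> en e' \<and> c e = c e')"
      using edge_colouringD(2)[OF c that(1,2)] that(3) by blast
    ultimately show ?thesis
      using F1[OF that(1)] F1[OF that(2)] lt[OF that(1)] lt[OF that(2)] by auto
  qed
  have "edge_colouring en (F \<union> {f, g}) (Suc n) c'"
    unfolding edge_colouring_def
  proof (intro conjI ballI impI)
    fix e assume "e \<in> F \<union> {f, g}"
    then show "c' e < Suc n" using F1[of e] F2 lt[of e] gam(1) by auto
  next
    fix e e' assume "e \<in> F \<union> {f, g}" "e' \<in> F \<union> {f, g}" "e \<noteq> e'" "en e \<inter> en e' \<noteq> {}"
    moreover have "c' f \<noteq> c' g" using F2 gam(1) by auto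
    ultimately show "c' e \<noteq> c' e'"
      using fF gF FF by (metis Int_commute Un_iff insert_iff singletonD)
  qed
  moreover have "c' e = c e \<or> (c e = \<gamma> \<and> c' e = n)" if "e \<in> F" for e
    using F1[OF that] by auto
  ultimately show thesis using that F2 by blast
qed

section \<open>Critical counterexamples\<close>

text \<open>The situation of a smallest subfamily that needs more than \<open>s + t - 2\<close>
  colours: \<open>small_cliques\<close> carries the bound on the clique number, and
  \<open>clique_removal\<close> is the negated conclusion of the theorem. The aim is a
  contradiction.\<close>

locale critical_family =
  fixes E :: "'e set" and en :: "'e \<Rightarrow> 'v set" and s t :: nat
  assumes finE: "finite E"
    and card_en: "e \<in> E \<Longrightarrow> card (en e) = 2"
    and s4: "4 \<le> s" and st: "s \<le> t"
    and not_colourable: "\<not> edge_colourable en E (s + t - 2)"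
    and critical: "e \<in> E \<Longrightarrow> edge_colourable en (E - {e}) (s + t - 2)"
    and small_cliques: "Q \<subseteq> E \<Longrightarrow> intersecting en Q \<Longrightarrow> card Q \<le> s + t - 2"
    and clique_removal: "Q \<subseteq> E \<Longrightarrow> intersecting en Q \<Longrightarrow> card Q = s \<Longrightarrow> edge_colourable en (E - Q) t"
begin

definition star :: "'v \<Rightarrow> 'e set" where "star v = {e \<in> E. v \<in> en e}"
definition deg :: "'v \<Rightarrow> nat" where "deg v = card (star v)"
definition link :: "'v \<Rightarrow> 'v \<Rightarrow> 'e set" where "link u v = {e \<in> E. en e = {u, v}}"
definition mult :: "'v \<Rightarrow> 'v \<Rightarrow> nat" where "mult u v = card (link u v)"
definition nbrs :: "'v \<Rightarrow> 'v set" where "nbrs v = {u. link v u \<noteq> {}}"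

lemma finite_star [simp]: "finite (star v)" using finE by (simp add: star_def)
lemma finite_link [simp]: "finite (link u v)" using finE by (simp add: link_def)

lemma link_commute: "link u v = link v u" by (simp add: link_def insert_commute)
lemma mult_commute: "mult u v = mult v u" by (simp add: mult_def link_commute)

lemma link_self: "link u u = {}"
  using card_en by (fastforce simp: link_def)

lemma en_cases:
  assumes "e \<in> E" "x \<in> en e"
  obtains u where "u \<noteq> x" "en e = {x, u}"
proof -
  obtain a b where "en e = {a, b}" "a \<noteq> b"
    using card_en[OF assms(1)] by (auto simp: card_2_iff)
  then show thesis using that[of a] that[of b] assms(2) by (auto simp: insert_commute)
qed

lemma star_Int: "u \<noteq> v \<Longrightarrow> star u \<inter> star v = link u v"
  by (auto simp: star_def link_def elim: en_cases)

lemma finite_nbrs [simp]: "finite (nbrs v)"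
proof (rule finite_subset)
  show "nbrs v \<subseteq> (\<Union>e\<in>E. en e)" by (auto simp: nbrs_def link_def)
  show "finite (\<Union>e\<in>E. en e)"
    using finE card_en by (metis card.infinite finite_UN_I zero_neq_numeral)
qed

lemma mem_nbrs_iff: "u \<in> nbrs v \<longleftrightarrow> mult v u > 0"
  by (simp add: nbrs_def mult_def card_gt_0_iff)

lemma nbrs_sym: "u \<in> nbrs v \<longleftrightarrow> v \<in> nbrs u"
  by (simp add: mem_nbrs_iff mult_commute)

lemma not_self_nbr: "v \<notin> nbrs v" by (simp add: nbrs_def link_self)

lemma deg_eq_sum: "deg v = (\<Sum>u\<in>nbrs v. mult v u)"
proof -
  have "star v = (\<Union>u\<in>nbrs v. link v u)"
  proof
    show "star v \<subseteq> (\<Union>u\<in>nbrs v. link v u)"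
    proof
      fix e assume "e \<in> star v"
      then have e: "e \<in> E" "v \<in> en e" by (auto simp: star_def)
      then obtain u where "en e = {v, u}" by (elim en_cases)
      then show "e \<in> (\<Union>u\<in>nbrs v. link v u)" using e by (auto simp: nbrs_def link_def)
    qed
  qed (auto simp: star_def link_def)
  moreover have "card (\<Union>u\<in>nbrs v. link v u) = (\<Sum>u\<in>nbrs v. mult v u)"
    unfolding mult_def using finE by (intro card_UN_disjoint) (auto simp: link_def doubleton_eq_iff)
  ultimately show ?thesis by (simp add: deg_def)
qed

lemma deg_ge_sum:
  assumes "finite S" shows "(\<Sum>u\<in>S. mult v u) \<le> deg v"
proof -
  have "(\<Sum>u\<in>S. mult v u) = (\<Sum>u\<in>S \<inter> nbrs v. mult v u)"
    using assms by (intro sum.mono_neutral_right) (auto simp: mem_nbrs_iff)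
  also have "\<dots> \<le> deg v" unfolding deg_eq_sum by (rule sum_mono2) auto
  finally show ?thesis .
qed

section \<open>Degree bounds from cliques, criticality and clique removal\<close>

lemma intersecting_subset_star: "Q \<subseteq> star x \<Longrightarrow> intersecting en Q"
  unfolding intersecting_def star_def by blast

lemma deg_le: "deg v \<le> s + t - 2"
  unfolding deg_def
  by (rule small_cliques) (auto intro: intersecting_subset_star simp: star_def)

lemma triangle_le:
  assumes "u \<noteq> v" "u \<noteq> w" "v \<noteq> w"
  shows "mult u v + mult u w + mult v w \<le> s + t - 2"
proof -
  have "card (link u v \<union> link u w \<union> link v w) \<le> s + t - 2"
    by (rule small_cliques) (auto simp: link_def intersecting_def)
  moreover have "link u v \<inter> link u w = {}" "(link u v \<union> link u w) \<inter> link v w = {}"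
    using assms by (auto simp: link_def doubleton_eq_iff)
  ultimately show ?thesis by (simp add: card_Un_disjoint mult_def)
qed

text \<open>When all edges except one edge \<open>e\<close> between \<open>u\<close> and
  \<open>v\<close> are coloured, every colour must occur on an edge meeting \<open>e\<close>, since
  otherwise \<open>e\<close> could receive it. There are \<open>deg u + deg v - mult u v - 1\<close>
  such edges.\<close>

lemma critical_deg:
  assumes "v \<in> nbrs u"
  shows "s + t - 1 + mult u v \<le> deg u + deg v"
proof (rule ccontr)
  assume neg: "\<not> ?thesis"
  have uv: "u \<noteq> v" using assms not_self_nbr by blast
  obtain e where e: "e \<in> E" "en e = {u, v}" using assms by (auto simp: nbrs_def link_def)
  obtain c where c: "edge_colouring en (E - {e}) (s + t - 2) c"
    using critical[OF e(1)] unfolding edge_colourable_def by blast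
  define N where "N = star u \<union> star v - {e}"
  have "e \<in> star u \<union> star v" using e by (auto simp: star_def)
  then have "card N = card (star u \<union> star v) - 1" by (simp add: N_def)
  moreover have "deg u + deg v = card (star u \<union> star v) + mult u v"
    unfolding deg_def mult_def star_Int[OF uv, symmetric] by (rule card_Un_Int) auto
  ultimately have "card N < s + t - 2" using neg s4 by linarith
  moreover have "finite N" by (simp add: N_def)
  ultimately have "card (c ` N) < card {..<s + t - 2}"
    using card_image_le[of N c] by simp
  then obtain \<gamma> where \<gamma>: "\<gamma> < s + t - 2" "\<gamma> \<notin> c ` N"
    using \<open>finite N\<close> by (metis card_mono finite_imageI leD lessThan_iff subsetI)
  have nb: "f \<in> N" if "f \<in> E" "f \<noteq> e" "en e \<inter> en f \<noteq> {}" for f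
    using that e by (auto simp: N_def star_def)
  have "edge_colouring en E (s + t - 2) (c(e := \<gamma>))"
    using c \<gamma> nb unfolding edge_colouring_def
    by (smt (verit) Diff_iff Int_commute fun_upd_apply image_eqI singletonD)
  then show False using not_colourable unfolding edge_colourable_def by blast
qed

text \<open>Remove \<open>s\<close> edges at \<open>y\<close>, avoiding \<open>x\<close> as far as
  possible. The edges left at \<open>x\<close> have different colours, so at most \<open>t\<close>
  of them remain; this bounds from below how many edges the removal had to take from
  \<open>x\<close>.\<close>

lemma two_large_degrees:
  assumes xy: "x \<noteq> y" and dx: "t + 1 \<le> deg x" and dy: "s \<le> deg y"
  shows "deg x + deg y \<le> s + t + mult x y"
proof (rule ccontr)
  assume neg: "\<not> ?thesis"
  have "card (star y \<inter> star x) + card (star y - star x) = card (star y)"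
    using card_Int_Diff[of "star y" "star x"] by simp
  then have split: "deg y = card (star y - star x) + mult x y"
    using star_Int[OF xy] by (simp add: deg_def mult_def Int_commute)
  obtain Q where Q: "Q \<subseteq> star y" "card Q = s" "t + 1 \<le> card (star x - Q)"
  proof (cases "s \<le> card (star y - star x)")
    case True
    then obtain Q where "Q \<subseteq> star y - star x" "card Q = s"
      by (meson obtain_subset_with_card_n)
    moreover from this have "star x - Q = star x" by auto
    ultimately show ?thesis using that[of Q] dx by (auto simp: deg_def)
  next
    case False
    \<comment> \<open>All edges at \<open>y\<close> that miss \<open>x\<close> go into
      \<open>Q\<close>, so it takes only \<open>s - card (star y - star x)\<close> edges from
      \<open>x\<close>.\<close>
    obtain Q where Q: "star y - star x \<subseteq> Q" "Q \<subseteq> star y" "card Q = s"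
      using exists_subset_between[of "star y - star x" s "star y"] False dy
      by (auto simp: deg_def)
    have fQ: "finite Q" using Q(2) finite_subset finite_star by blast
    have "Q \<inter> star x = Q - (star y - star x)" using Q by auto
    then have "card (Q \<inter> star x) = s - card (star y - star x)"
      using Q card_Diff_subset[of "star y - star x" Q] by simp
    moreover have "card (star x - Q) = deg x - card (Q \<inter> star x)"
      using card_Diff_subset_Int[of "star x" Q] fQ by (simp add: deg_def Int_commute)
    ultimately have "t + 1 \<le> card (star x - Q)" using neg split False by linarith
    then show ?thesis using that Q by blast
  qed
  have QE: "Q \<subseteq> E" using Q(1) by (auto simp: star_def)
  obtain c where c: "edge_colouring en (E - Q) t c"
    using clique_removal[OF QE intersecting_subset_star[OF Q(1)] Q(2)]
    unfolding edge_colourable_def by blast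
  have "inj_on c (star x - Q)"
    using edge_colouringD(2)[OF c] by (auto simp: inj_on_def star_def)
  moreover have "c ` (star x - Q) \<subseteq> {..<t}"
    using edge_colouringD(1)[OF c] by (auto simp: star_def)
  ultimately have "card (star x - Q) \<le> t"
    using card_inj_on_le[of c "star x - Q" "{..<t}"] by simp
  then show False using Q(3) by simp
qed

section \<open>Missing colours and the number of neighbours\<close>

definition missing :: "'e set \<Rightarrow> ('e \<Rightarrow> nat) \<Rightarrow> 'v \<Rightarrow> nat set" where
  "missing Q c x = {\<gamma>. \<gamma> < t \<and> (\<forall>e\<in>star x - Q. c e \<noteq> \<gamma>)}"

text \<open>The \<open>deg x - s\<close> edges left at \<open>x\<close> use up that many of the
  \<open>t\<close> colours. With \<open>deg_le\<close>, at least two colours are missing.\<close>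

lemma card_missing:
  assumes "Q \<subseteq> star x" "card Q = s" "edge_colouring en (E - Q) t c"
  shows "card (missing Q c x) + deg x = s + t"
proof -
  have "inj_on c (star x - Q)"
    using edge_colouringD(2)[OF assms(3)] by (auto simp: inj_on_def star_def)
  moreover have sub: "c ` (star x - Q) \<subseteq> {..<t}"
    using edge_colouringD(1)[OF assms(3)] by (auto simp: star_def)
  moreover have "missing Q c x = {..<t} - c ` (star x - Q)"
    by (auto simp: missing_def)
  moreover have "card (star x - Q) = deg x - s" "s \<le> deg x"
    using assms(1,2) finite_subset[OF assms(1)] card_mono[OF _ assms(1)]
    by (auto simp: card_Diff_subset deg_def)
  ultimately show ?thesis
    using card_mono[OF _ sub] by (simp add: card_Diff_subset card_image)
qed

text \<open>Two applications of the pair extension use the \<open>s - 2\<close> new colours for all \<open>s\<close> edges of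
  \<open>Q\<close>.\<close>

lemma no_two_free_pairs:
  assumes Q: "Q \<subseteq> star x" "card Q = s" and c: "edge_colouring en (E - Q) t c"
    and F: "{f1, g1, f2, g2} \<subseteq> Q" "distinct [f1, g1, f2, g2]"
    and f1: "en f1 = {x, u1}" and g1: "en g1 = {x, v1}"
    and f2: "en f2 = {x, u2}" and g2: "en g2 = {x, v2}"
    and uv: "u1 \<noteq> v1" "u2 \<noteq> v2"
    and M: "a \<in> missing Q c x" "b \<in> missing Q c x" "a \<noteq> b"
  shows "a \<in> c ` link u1 v1 \<or> b \<in> c ` link u2 v2"
proof (rule ccontr)
  assume neg: "\<not> ?thesis"
  have QE: "Q \<subseteq> E" and fQ: "finite Q" using Q finE by (auto simp: star_def intro: finite_subset)
  have lk: "e \<in> link u v" if "e \<in> E" "u \<in> en e" "v \<in> en e" "u \<noteq> v" for e u v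
    using that star_Int[of u v] by (auto simp: star_def)
  have m: "\<gamma> < t" "\<And>e. e \<in> E - Q \<Longrightarrow> x \<in> en e \<Longrightarrow> c e \<noteq> \<gamma>" if "\<gamma> \<in> missing Q c x" for \<gamma>
    using that by (auto simp: missing_def star_def)
  obtain c1 where c1: "edge_colouring en ((E - Q) \<union> {f1, g1}) (Suc t) c1" "c1 f1 = a" "c1 g1 = t"
    "\<And>e. e \<in> E - Q \<Longrightarrow> c1 e = c e \<or> (c e = a \<and> c1 e = t)"
  proof (rule edge_colouring_pair_extension[OF c _ f1 _ g1 uv(1), of a])
    show "f1 \<notin> E - Q" "g1 \<notin> E - Q" using F by auto
    show "c e \<noteq> a" if "e \<in> E - Q" "u1 \<in> en e" "v1 \<in> en e" for e
      using that lk[of e u1 v1] uv neg by auto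
  qed (use m[OF M(1)] in auto)
  \<comment> \<open>The first exchange recolours old edges only to \<open>t\<close>, and
    \<open>b < t\<close>; hence no old edge acquires colour \<open>b\<close>, and the second
    exchange can be judged by \<open>c\<close>.\<close>
  have keep: "c1 e = b \<Longrightarrow> c e = b" if "e \<in> E - Q" for e
    using c1(4)[OF that] m(1)[OF M(2)] by auto
  have ne: "c1 f1 \<noteq> b" "c1 g1 \<noteq> b" using c1(2,3) M(3) m(1)[OF M(2)] by auto
  obtain c2 where c2: "edge_colouring en ((E - Q) \<union> {f1, g1} \<union> {f2, g2}) (Suc (Suc t)) c2"
  proof (rule edge_colouring_pair_extension[OF c1(1) _ f2 _ g2 uv(2), of b])
    show "f2 \<notin> (E - Q) \<union> {f1, g1}" "g2 \<notin> (E - Q) \<union> {f1, g1}" using F by auto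
    show "b < Suc t" using m(1)[OF M(2)] by simp
    show "c1 e \<noteq> b" if "e \<in> (E - Q) \<union> {f1, g1}" "x \<in> en e" for e
      using that keep ne m(2)[OF M(2)] by blast
    show "c1 e \<noteq> b" if "e \<in> (E - Q) \<union> {f1, g1}" "u2 \<in> en e" "v2 \<in> en e" for e
    proof
      assume "c1 e = b"
      then have "e \<in> E - Q" "c e = b" using that(1) keep ne by auto
      then show False using neg lk[of e u2 v2] that uv by auto
    qed
  qed
  let ?R = "Q - {f1, g1, f2, g2}"
  have "card ?R = s - 4" using Q(2) F by (simp add: card_Diff_subset)
  moreover have "(E - Q) \<union> {f1, g1} \<union> {f2, g2} \<union> ?R = E" using F QE by auto
  moreover have "edge_colourable en ((E - Q) \<union> {f1, g1} \<union> {f2, g2} \<union> ?R) (Suc (Suc t) + card ?R)"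
    using c2 fQ by (intro edge_colourable_Un edge_colourable_card) (auto simp: edge_colourable_def)
  moreover have "Suc (Suc t) + (s - 4) = s + t - 2" using s4 by simp
  ultimately show False using not_colourable by metis
qed

text \<open>\<open>P\<close> will consist of the four edges to which
  \<open>no_two_free_pairs\<close> is applied.\<close>

lemma obtain_star_subset:
  assumes "s \<le> deg x" "P \<subseteq> star x" "card P = 4"
  obtains Q c where "P \<subseteq> Q" "Q \<subseteq> star x" "card Q = s" "edge_colouring en (E - Q) t c"
proof -
  obtain Q where Q: "P \<subseteq> Q" "Q \<subseteq> star x" "card Q = s"
    using exists_subset_between[of P s "star x"] assms s4 by (auto simp: deg_def)
  moreover have "Q \<subseteq> E" using Q(2) by (auto simp: star_def)
  ultimately show thesis
    using that clique_removal[OF _ intersecting_subset_star[OF Q(2)]]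
    unfolding edge_colourable_def by blast
qed

text \<open>Both links avoid \<open>x\<close>, hence avoid \<open>Q\<close>, and they share the
  vertex \<open>u\<close>, where a colour occurs only once.\<close>

lemma colour_link_unique:
  assumes "Q \<subseteq> star x" "edge_colouring en (E - Q) t c" "x \<notin> {u, v, w}" "v \<noteq> w"
    and "a \<in> c ` link u v"
  shows "a \<notin> c ` link u w"
proof
  assume "a \<in> c ` link u w"
  then obtain f where f: "f \<in> E" "en f = {u, w}" "c f = a" by (auto simp: link_def)
  obtain e where e: "e \<in> E" "en e = {u, v}" "c e = a" using assms(5) by (auto simp: link_def)
  have "e \<notin> Q" "f \<notin> Q" using assms(1,3) e f by (auto simp: star_def)
  then have "e = f" using edge_colouringD(2)[OF assms(2), of e f u] e f by auto
  then show False using e f assms(4) by (auto simp: doubleton_eq_iff)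
qed

text \<open>Four neighbours split into two pairs in three ways, and each splitting needs
  \<open>a\<close> on the pair with \<open>u1\<close> or \<open>b\<close> on the other pair. The
  pairs offered to \<open>a\<close> share \<open>u1\<close>, and any two offered to \<open>b\<close>
  share a vertex, so each colour serves at most one splitting.\<close>

lemma card_nbrs_le_3:
  assumes "s \<le> deg x"
  shows "card (nbrs x) \<le> 3"
proof (rule ccontr)
  assume "\<not> ?thesis"
  then obtain S where S: "S \<subseteq> nbrs x" "card S = 4"
    by (metis not_less_eq_eq eval_nat_numeral(2,3) obtain_subset_with_card_n semiring_norm(26,27))
  then obtain u1 u2 u3 u4 where u: "S = {u1, u2, u3, u4}" "distinct [u1, u2, u3, u4]"
    by (auto simp: card_Suc_eq eval_nat_numeral)
  then obtain f1 f2 f3 f4 where f: "f1 \<in> link x u1" "f2 \<in> link x u2" "f3 \<in> link x u3" "f4 \<in> link x u4"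
    using S(1) by (auto simp: nbrs_def)
  have en: "en f1 = {x, u1}" "en f2 = {x, u2}" "en f3 = {x, u3}" "en f4 = {x, u4}"
    using f by (auto simp: link_def)
  have xu: "x \<notin> {u1, u2, u3, u4}" using S(1) u(1) not_self_nbr by blast
  have d: "distinct [f1, f2, f3, f4]" using en u(2) by (auto simp: doubleton_eq_iff)
  obtain Q c where Q: "{f1, f2, f3, f4} \<subseteq> Q" "Q \<subseteq> star x" "card Q = s"
    "edge_colouring en (E - Q) t c"
    by (rule obtain_star_subset[OF assms, of "{f1, f2, f3, f4}"]) (use f d in \<open>auto simp: link_def star_def\<close>)
  have "2 \<le> card (missing Q c x)"
    using card_missing[OF Q(2-4)] deg_le[of x] s4 by linarith
  then obtain a b where ab: "a \<in> missing Q c x" "b \<in> missing Q c x" "a \<noteq> b"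
    by (rule two_le_card_obtain)
  note free = no_two_free_pairs[OF Q(2-4) _ _ _ _ _ _ _ _ ab]
  have p1: "a \<in> c ` link u1 u2 \<or> b \<in> c ` link u3 u4"
    by (rule free[of f1 f2 f3 f4]) (use Q d en u in auto)
  have p2: "a \<in> c ` link u1 u3 \<or> b \<in> c ` link u2 u4"
    by (rule free[of f1 f3 f2 f4]) (use Q d en u in auto)
  have p3: "a \<in> c ` link u1 u4 \<or> b \<in> c ` link u2 u3"
    by (rule free[of f1 f4 f2 f3]) (use Q d en u in auto)
  have un: "\<gamma> \<in> c ` link u v \<Longrightarrow> \<gamma> \<notin> c ` link u w"
    if "u \<in> S" "v \<in> S" "w \<in> S" "v \<noteq> w" for u v w \<gamma>
    using colour_link_unique[OF Q(2,4), of u v w] that xu u(1) by blast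
  have "a \<in> c ` link u1 u2 \<Longrightarrow> a \<notin> c ` link u1 u3" "a \<in> c ` link u1 u2 \<Longrightarrow> a \<notin> c ` link u1 u4"
    "a \<in> c ` link u1 u3 \<Longrightarrow> a \<notin> c ` link u1 u4"
    using un[of u1 u2 u3 a] un[of u1 u2 u4 a] un[of u1 u3 u4 a] u by simp_all
  moreover have "b \<in> c ` link u3 u4 \<Longrightarrow> b \<notin> c ` link u2 u4" "b \<in> c ` link u3 u4 \<Longrightarrow> b \<notin> c ` link u2 u3"
    "b \<in> c ` link u2 u4 \<Longrightarrow> b \<notin> c ` link u2 u3"
    using un[of u4 u2 u3 b] un[of u3 u2 u4 b] un[of u2 u3 u4 b] u
    by (auto simp: link_commute[of u4 u3] link_commute[of u4 u2] link_commute[of u3 u2])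
  ultimately show False using p1 p2 p3 by blast
qed

lemma card_le_mult:
  assumes "A \<subseteq> c ` link u v"
  shows "card A \<le> mult u v"
  using surj_card_le[OF finite_link assms] by (simp add: mult_def)

lemma obtain_two_links:
  assumes "2 \<le> mult x u"
  obtains e f where "e \<in> link x u" "f \<in> link x u" "e \<noteq> f"
  using assms unfolding mult_def by (rule two_le_card_obtain)

section \<open>Pairs of neighbours joined by many edges\<close>

text \<open>Both exchanges use an edge to \<open>u\<close> and an edge to \<open>v\<close>, so at
  most one missing colour is absent from \<open>link u v\<close>. Counting the missing colours gives
  the bound.\<close>

lemma heavy_pair_two_nbrs:
  assumes "s \<le> deg x" "u \<noteq> v" "2 \<le> mult x u" "2 \<le> mult x v"
  shows "s + t - 1 \<le> mult u v + deg x"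
proof -
  obtain f1 f2 where f: "f1 \<in> link x u" "f2 \<in> link x u" "f1 \<noteq> f2"
    using obtain_two_links[OF assms(3)] by blast
  obtain g1 g2 where g: "g1 \<in> link x v" "g2 \<in> link x v" "g1 \<noteq> g2"
    using obtain_two_links[OF assms(4)] by blast
  have en: "en f1 = {x, u}" "en f2 = {x, u}" "en g1 = {x, v}" "en g2 = {x, v}"
    using f g by (auto simp: link_def)
  have d: "distinct [f1, g1, f2, g2]" using en assms(2) f g by (auto simp: doubleton_eq_iff)
  obtain Q c where Q: "{f1, g1, f2, g2} \<subseteq> Q" "Q \<subseteq> star x" "card Q = s"
    "edge_colouring en (E - Q) t c"
    by (rule obtain_star_subset[OF assms(1), of "{f1, g1, f2, g2}"])
      (use f g d in \<open>auto simp: link_def star_def\<close>)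
  let ?A = "missing Q c x - c ` link u v"
  have "a = b" if "a \<in> ?A" "b \<in> ?A" for a b
    using no_two_free_pairs[OF Q(2-4,1) d en(1,3,2,4) assms(2,2), of a b] that by blast
  then have "card ?A \<le> 1" by (metis One_nat_def card_le_Suc0_iff_eq card.infinite zero_le_one)
  moreover have "card (missing Q c x) \<le> card ?A + card (missing Q c x \<inter> c ` link u v)"
    by (metis card_Un_le Un_Diff_Int)
  moreover have "card (missing Q c x \<inter> c ` link u v) \<le> mult u v"
    by (rule card_le_mult) auto
  ultimately show ?thesis using card_missing[OF Q(2-4)] by linarith
qed

text \<open>The exchanges use the pairs \<open>u\<close>, \<open>v\<close> and \<open>u\<close>,
  \<open>w\<close>. No colour lies on both \<open>link u v\<close> and \<open>link u w\<close>,
  which forces all missing colours onto one of these links.\<close>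

lemma heavy_pair_three_nbrs:
  assumes "s \<le> deg x" "distinct [u, v, w]" "{u, v, w} \<subseteq> nbrs x" "2 \<le> mult x u"
  shows "s + t \<le> mult u v + deg x \<or> s + t \<le> mult u w + deg x"
proof -
  obtain f1 f2 where f: "f1 \<in> link x u" "f2 \<in> link x u" "f1 \<noteq> f2"
    using obtain_two_links[OF assms(4)] by blast
  obtain g h where g: "g \<in> link x v" "h \<in> link x w" using assms(3) by (auto simp: nbrs_def)
  have en: "en f1 = {x, u}" "en f2 = {x, u}" "en g = {x, v}" "en h = {x, w}"
    using f g by (auto simp: link_def)
  have d: "distinct [f1, g, f2, h]" using en assms(2) f g by (auto simp: doubleton_eq_iff)
  obtain Q c where Q: "{f1, g, f2, h} \<subseteq> Q" "Q \<subseteq> star x" "card Q = s"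
    "edge_colouring en (E - Q) t c"
    by (rule obtain_star_subset[OF assms(1), of "{f1, g, f2, h}"])
      (use f g d in \<open>auto simp: link_def star_def\<close>)
  let ?M = "missing Q c x"
  have free: "a \<in> c ` link u v \<or> b \<in> c ` link u w" if "a \<in> ?M" "b \<in> ?M" "a \<noteq> b" for a b
    by (rule no_two_free_pairs[OF Q(2-4,1) d en(1,3,2,4) _ _ that]) (use assms(2) in auto)
  have un: "a \<notin> c ` link u w" if "a \<in> c ` link u v" for a
    by (rule colour_link_unique[OF Q(2,4) _ _ that])
      (use assms(2,3) not_self_nbr in auto)
  have "2 \<le> card ?M"
    using card_missing[OF Q(2-4)] deg_le[of x] s4 by linarith
  then obtain a b where ab: "a \<in> ?M" "b \<in> ?M" "a \<noteq> b"
    by (rule two_le_card_obtain)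
  have "?M \<subseteq> c ` link u v \<or> ?M \<subseteq> c ` link u w"
  proof (rule ccontr)
    assume "\<not> ?thesis"
    \<comment> \<open>A missing colour off \<open>link u v\<close> and one off
      \<open>link u w\<close> must coincide; any other missing colour would then lie on both
      links.\<close>
    then obtain p q where pq: "p \<in> ?M" "p \<notin> c ` link u v" "q \<in> ?M" "q \<notin> c ` link u w" by blast
    then have "p = q" using free by blast
    obtain r where "r \<in> ?M" "r \<noteq> p" using ab by blast
    then have "r \<in> c ` link u v" "r \<in> c ` link u w"
      using free[of r q] free[of p r] pq \<open>p = q\<close> by auto
    then show False using un by blast
  qed
  then have "card ?M \<le> mult u v \<or> card ?M \<le> mult u w" using card_le_mult by blast
  then show ?thesis using card_missing[OF Q(2-4)] by linarith
qed

lemma deg_three: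
  assumes "nbrs x = {u, v, w}" "distinct [u, v, w]"
  shows "deg x = mult x u + mult x v + mult x w"
  using assms by (simp add: deg_eq_sum)

text \<open>A neighbour joined to \<open>x\<close> by two edges lies in a heavy pair. The triangle
  bound then gives the neighbour outside this pair two edges to \<open>x\<close>, so it lies in a
  heavy pair as well. The two pairs differ and share one vertex, which becomes
  \<open>u\<close>.\<close>

lemma two_heavy_pairs:
  assumes big: "s \<le> deg x" and "card (nbrs x) = 3"
  obtains u v w where "nbrs x = {u, v, w}" "distinct [u, v, w]"
    "s + t \<le> mult u v + deg x" "s + t \<le> mult u w + deg x"
proof -
  have step: "\<exists>v w. nbrs x = {u, v, w} \<and> distinct [u, v, w] \<and> 2 \<le> mult x w \<and>
      s + t \<le> mult u v + deg x"
    if u: "u \<in> nbrs x" "2 \<le> mult x u" for u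
  proof -
    obtain v w where vw: "nbrs x = {u, v, w}" "distinct [u, v, w]"
    proof -
      have "card (nbrs x - {u}) = 2" using u assms(2) by simp
      then obtain v w where "nbrs x - {u} = {v, w}" "v \<noteq> w" by (auto simp: card_2_iff)
      moreover from this have "nbrs x = {u, v, w}" "distinct [u, v, w]" using u by auto
      ultimately show thesis using that by blast
    qed
    have two: "2 \<le> mult x w'" if "s + t \<le> mult u v' + deg x" "nbrs x = {u, v', w'}" "distinct [u, v', w']"
      for v' w'
    proof -
      have "mult x u + mult x v' + mult u v' \<le> s + t - 2"
        by (rule triangle_le) (use that(2,3) not_self_nbr in auto)
      then show ?thesis using deg_three[OF that(2,3)] that(1) s4 by linarith
    qed
    have "nbrs x = {u, w, v}" "distinct [u, w, v]" using vw by auto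
    then show ?thesis
      using heavy_pair_three_nbrs[OF big vw(2) _ u(2)] vw two[of v w] two[of w v] by blast
  qed
  \<comment> \<open>Otherwise \<open>deg x\<close> would be at most 3, below
    \<open>s\<close>.\<close>
  obtain u0 where u0: "u0 \<in> nbrs x" "2 \<le> mult x u0"
  proof (rule ccontr)
    assume "\<not> thesis"
    then have "\<And>u. u \<in> nbrs x \<Longrightarrow> mult x u \<le> 1" using that by force
    then have "deg x \<le> card (nbrs x)" using sum_bounded_above[of "nbrs x" "mult x" 1]
      by (simp add: deg_eq_sum)
    then show False using big s4 assms(2) by simp
  qed
  obtain v w where 1: "nbrs x = {u0, v, w}" "distinct [u0, v, w]" "2 \<le> mult x w"
    "s + t \<le> mult u0 v + deg x" using step[OF u0] by blast
  obtain v' w' where 2: "nbrs x = {w, v', w'}" "distinct [w, v', w']"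
    "s + t \<le> mult w v' + deg x" using step[of w] 1 by auto
  have "v' = u0 \<and> w' = v \<or> v' = v \<and> w' = u0"
    using 1(1,2) 2(1,2) by auto
  then show thesis
  proof
    assume "v' = u0 \<and> w' = v"
    then show thesis using that[of u0 v w] 1 2 by (auto simp: mult_commute)
  next
    assume "v' = v \<and> w' = u0"
    then show thesis using that[of v u0 w] 1 2 u0 by (auto simp: mult_commute)
  qed
qed

section \<open>Excluding one or two neighbours\<close>

text \<open>Criticality would push the degree of the only neighbour up to
  \<open>s + t - 1\<close>.\<close>

lemma card_nbrs_neq_1: "card (nbrs x) \<noteq> 1"
proof
  assume "card (nbrs x) = 1"
  then obtain y where y: "nbrs x = {y}" by (auto simp: card_1_singleton_iff)
  then have "deg x = mult x y" by (simp add: deg_eq_sum)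
  then show False using critical_deg[of y x] y deg_le[of y] s4 by simp
qed

text \<open>Otherwise the heavy pair \<open>u\<close>, \<open>v\<close> would form with
  \<open>x\<close> a triangle of at least \<open>s + t - 1\<close> edges.\<close>

lemma two_nbrs_simple_edge:
  assumes "s \<le> deg x" "nbrs x = {u, v}" "u \<noteq> v"
  shows "mult x u = 1 \<or> mult x v = 1"
proof (rule ccontr)
  assume "\<not> ?thesis"
  moreover have "mult x u > 0" "mult x v > 0" using assms(2) by (simp_all flip: mem_nbrs_iff)
  ultimately have "2 \<le> mult x u" "2 \<le> mult x v" by linarith+
  then have "s + t - 1 \<le> mult u v + deg x" using heavy_pair_two_nbrs assms by blast
  moreover have "mult x u + mult x v + mult u v \<le> s + t - 2"
    using assms not_self_nbr by (intro triangle_le) auto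
  moreover have "deg x = mult x u + mult x v" using assms by (simp add: deg_eq_sum)
  ultimately show False using s4 by linarith
qed

lemma card_nbrs_neq_2:
  assumes big: "s \<le> deg x"
  shows "card (nbrs x) \<noteq> 2"
proof
  assume "card (nbrs x) = 2"
  then obtain u v where nx: "nbrs x = {u, v}" "u \<noteq> v" and v1: "mult x v = 1"
    using two_nbrs_simple_edge[OF big] by (metis card_2_iff insert_commute)
  have xuv: "x \<noteq> u" "x \<noteq> v" using nx not_self_nbr by blast+
  have dx: "deg x = mult x u + 1" using nx v1 by (simp add: deg_eq_sum)
  \<comment> \<open>Since \<open>deg x\<close> exceeds \<open>mult x u\<close> by only one,
    criticality leaves \<open>u\<close> no slack below the maximal degree.\<close>
  have du: "deg u = s + t - 2"
    using critical_deg[of u x] nx dx deg_le[of u] s4 by simp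
  have bigu: "s \<le> deg u" using du s4 st by linarith
  have xu: "x \<in> nbrs u" using nx nbrs_sym by blast
  have "card (nbrs u) \<noteq> 0" using xu by auto
  then consider "card (nbrs u) = 2" | "card (nbrs u) = 3"
    using card_nbrs_le_3[OF bigu] card_nbrs_neq_1[of u] by linarith
  then show False
  proof cases
    \<comment> \<open>Here \<open>x\<close> and \<open>u\<close> both have maximal degree and
      \<open>v\<close> is not adjacent to \<open>u\<close>. This makes \<open>deg v\<close> small,
      so a further neighbour \<open>y\<close> of \<open>v\<close> has large degree; but
      \<open>x\<close> and \<open>y\<close> are not adjacent.\<close>
    case 1
    then obtain v' where nu: "nbrs u = {x, v'}" "x \<noteq> v'"
      using xu by (metis card_2_iff doubleton_eq_iff insert_iff singletonD)
    have uv': "u \<noteq> v'" using nu not_self_nbr by blast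
    have "mult u v' = 1"
      using two_nbrs_simple_edge[OF bigu nu] dx big s4 by (auto simp: mult_commute)
    then have dxu: "deg x = s + t - 2" "mult x u = s + t - 3"
      using nu du dx s4 by (simp_all add: deg_eq_sum mult_commute[of u x])
    have "v' \<noteq> v"
    proof
      assume "v' = v"
      then have "mult x u + mult x v + mult u v \<le> s + t - 2"
        using xuv nx by (intro triangle_le) auto
      then show False using dxu v1 \<open>mult u v' = 1\<close> \<open>v' = v\<close> s4 by simp
    qed
    then have "v \<notin> nbrs u" using nu xuv by auto
    then have uv: "mult u v = 0" by (simp add: mem_nbrs_iff)
    have "deg v < s"
      using two_large_degrees[of u v] nx uv du s4 by linarith
    have "nbrs v \<noteq> {x}" using card_nbrs_neq_1[of v] by auto
    moreover have "x \<in> nbrs v" using nx nbrs_sym by blast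
    ultimately obtain y where y: "y \<in> nbrs v" "y \<noteq> x" by blast
    have "mult v y > 0" using y by (simp add: mem_nbrs_iff)
    then have dy: "t + 1 \<le> deg y"
      using critical_deg[OF y(1)] \<open>deg v < s\<close> by linarith
    have "y \<noteq> u" "y \<noteq> v" using y \<open>v \<notin> nbrs u\<close> nbrs_sym not_self_nbr by blast+
    then have "y \<notin> nbrs x" using nx by auto
    then have "mult x y = 0" by (simp add: mem_nbrs_iff)
    then show False
      using two_large_degrees[OF y(2)[symmetric]] dy dxu s4 st by linarith
  next
    \<comment> \<open>The two heavy pairs at \<open>u\<close> cover its three neighbours, so
      \<open>x\<close> has at least two edges to some neighbour of \<open>u\<close>. That vertex
      could only be \<open>v\<close>, to which \<open>x\<close> has one edge.\<close>
    case 2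
    obtain p q r where pqr: "nbrs u = {p, q, r}" "distinct [p, q, r]"
      "s + t \<le> mult p q + deg u" "s + t \<le> mult p r + deg u"
      by (rule two_heavy_pairs[OF bigu 2])
    have "2 \<le> mult p q" "2 \<le> mult p r" "2 \<le> mult q p" "2 \<le> mult r p"
      using pqr(3,4) du s4 by (simp_all add: mult_commute[of _ p])
    moreover have "x = p \<or> x = q \<or> x = r" "p \<in> nbrs u" "q \<in> nbrs u" using xu pqr(1) by auto
    ultimately obtain y where y: "y \<in> nbrs u" "2 \<le> mult x y" by blast
    then have "y \<in> nbrs x" by (simp add: mem_nbrs_iff)
    then show False using y nx v1 not_self_nbr by auto
  qed
qed

lemma card_nbrs_eq_3:
  assumes "s \<le> deg x"
  shows "card (nbrs x) = 3"
proof -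
  have "card (nbrs x) \<noteq> 0" using assms s4 by (auto simp: deg_eq_sum)
  then show ?thesis
    using card_nbrs_le_3[OF assms] card_nbrs_neq_1[of x] card_nbrs_neq_2[OF assms] by linarith
qed

text \<open>Opposite links share their colours. Choosing the larger link of each of the three opposite
  pairs yields a star or a triangle.\<close>

lemma four_vertices_colourable:
  assumes d: "distinct [x, u, v, w]"
  shows "edge_colourable en {e \<in> E. en e \<subseteq> {x, u, v, w}} (s + t - 2)"
proof -
  have pair: "edge_colourable en (link a b \<union> link p q) (max (mult a b) (mult p q))"
    if "distinct [a, b, p, q]" for a b p q
  proof (rule edge_colourable_disjoint_Un)
    show "edge_colourable en (link a b) (max (mult a b) (mult p q))"
      "edge_colourable en (link p q) (max (mult a b) (mult p q))"
      unfolding mult_def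
      by (rule edge_colourable_mono[OF edge_colourable_card[OF finite_link] subset_refl], simp)+
  qed (use that in \<open>auto simp: link_def\<close>)
  have "edge_colourable en ((link x u \<union> link v w) \<union> (link x v \<union> link u w) \<union> (link x w \<union> link u v))
     (max (mult x u) (mult v w) + max (mult x v) (mult u w) + max (mult x w) (mult u v))"
    using d by (intro edge_colourable_Un pair) auto
  moreover have "{e \<in> E. en e \<subseteq> {x, u, v, w}} \<subseteq>
      (link x u \<union> link v w) \<union> (link x v \<union> link u w) \<union> (link x w \<union> link u v)"
  proof
    fix e assume "e \<in> {e \<in> E. en e \<subseteq> {x, u, v, w}}"
    then have e: "e \<in> E" "en e \<subseteq> {x, u, v, w}" by auto
    obtain a b where ab: "en e = {a, b}" "a \<noteq> b" using card_en[OF e(1)] by (auto simp: card_2_iff)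
    then have "a \<in> {x, u, v, w}" "b \<in> {x, u, v, w}" using e(2) by auto
    then show "e \<in> (link x u \<union> link v w) \<union> (link x v \<union> link u w) \<union> (link x w \<union> link u v)"
      using ab e(1) by (auto simp: link_def insert_commute)
  qed
  moreover have "max (mult x u) (mult v w) + max (mult x v) (mult u w) + max (mult x w) (mult u v)
      \<le> s + t - 2"
  proof -
    have st3: "mult a b + mult a p + mult a q \<le> s + t - 2" if "distinct [b, p, q]" for a b p q
      using deg_ge_sum[of "{b, p, q}" a] deg_le[of a] that by simp
    have "mult x u + mult x v + mult x w \<le> s + t - 2" "mult x u + mult u v + mult u w \<le> s + t - 2"
      "mult x v + mult u v + mult v w \<le> s + t - 2" "mult x w + mult u w + mult v w \<le> s + t - 2"
      using st3[of u v w x] st3[of x v w u] st3[of x u w v] st3[of x u v w] d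
      by (auto simp: mult_commute)
    moreover have "mult x u + mult x v + mult u v \<le> s + t - 2" "mult x u + mult x w + mult u w \<le> s + t - 2"
      "mult x v + mult x w + mult v w \<le> s + t - 2" "mult u v + mult u w + mult v w \<le> s + t - 2"
      using d by (auto intro!: triangle_le)
    ultimately show ?thesis by (simp add: max_def)
  qed
  ultimately show ?thesis by (rule edge_colourable_mono)
qed

section \<open>The component with four vertices and the contradiction\<close>

text \<open>A vertex \<open>x\<close> of degree at least \<open>s\<close> and its three neighbours
  turn out to be joined to each other and to nothing else. This component and the remaining edges
  can be coloured independently.\<close>

lemma inconsistent: False
proof -
  have "E \<noteq> {}"
    using not_colourable by (auto simp: edge_colourable_def edge_colouring_def)
  then obtain e where e: "e \<in> E" by blast
  then obtain y z where yz: "en e = {y, z}" "y \<noteq> z" using card_en by (metis card_2_iff)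
  then have "z \<in> nbrs y" using e by (auto simp: nbrs_def link_def)
  then have "s + t \<le> deg y + deg z"
    using critical_deg[of z y] by (simp add: mem_nbrs_iff)
  then obtain x where x: "s \<le> deg x" using st by (metis add_mono not_le add_less_mono order_le_less_trans)
  obtain u v w where nx: "nbrs x = {u, v, w}" and d: "distinct [u, v, w]"
    and uv: "s + t \<le> mult u v + deg x" and uw: "s + t \<le> mult u w + deg x"
    by (rule two_heavy_pairs[OF x card_nbrs_eq_3[OF x]])
  have dist: "distinct [x, u, v, w]" using d nx not_self_nbr by auto
  have uvw: "v \<in> nbrs u" "w \<in> nbrs u" using uv uw deg_le[of x] s4 by (auto simp: mem_nbrs_iff)
  have du: "mult x u + mult u v + mult u w \<le> deg u"
    using deg_ge_sum[of "{x, v, w}" u] dist by (simp add: mult_commute)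
  \<comment> \<open>The heavy links at \<open>u\<close> make \<open>deg x + deg u\<close> at least
    \<open>s + t + 2 + mult x u\<close>, too much for \<open>two_large_degrees\<close>.\<close>
  have xu: "\<not> (t + 1 \<le> deg x \<and> s \<le> deg u)" "\<not> t + 1 \<le> deg u"
    using two_large_degrees[of x u] two_large_degrees[of u x] x du uv uw deg_le[of x] dist s4
    by (auto simp: mult_commute[of u x])
  have third: "deg x \<le> t \<and> deg y \<le> t" if y: "s \<le> deg y" "y \<in> {v, w}" for y
  proof (rule ccontr)
    assume neg: "\<not> ?thesis"
    have y': "y \<noteq> x" "y \<noteq> u" "s + t \<le> mult u y + deg x" using y uv uw dist by auto
    \<comment> \<open>The third neighbour \<open>z\<close> of \<open>y\<close> adds an edge beyond
      those to \<open>x\<close> and \<open>u\<close>, which already exhaust the bound of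
      \<open>two_large_degrees\<close>.\<close>
    have "\<not> nbrs y \<subseteq> {x, u}"
      using card_nbrs_eq_3[OF y(1)] card_mono[of "{x, u}" "nbrs y"] dist by auto
    then obtain z where z: "z \<in> nbrs y" "z \<noteq> x" "z \<noteq> u" by blast
    have "mult y x + mult y u + mult y z \<le> deg y"
      using deg_ge_sum[of "{x, u, z}" y] z dist by simp
    moreover have "mult y z > 0" using z by (simp add: mem_nbrs_iff)
    moreover have "deg x + deg y \<le> s + t + mult x y"
      using two_large_degrees[of x y] two_large_degrees[of y x] neg x y(1) y'(1)
      by (auto simp: mult_commute[of y x])
    ultimately show False using y'(3) by (simp add: mult_commute)
  qed
  \<comment> \<open>A small \<open>deg u\<close> would by criticality make \<open>deg v\<close>
    exceed \<open>t\<close>, against \<open>third\<close>; the next claim reverses the roles and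
    contradicts \<open>xu\<close>.\<close>
  have bu: "s \<le> deg u"
  proof (rule ccontr)
    assume "\<not> ?thesis"
    moreover have "mult u v > 0" using uvw by (simp add: mem_nbrs_iff)
    ultimately have "t + 1 \<le> deg v" using critical_deg[OF uvw(1)] by linarith
    then show False using third[of v] st by simp
  qed
  have big: "s \<le> deg y" if "y \<in> nbrs u" for y
  proof (rule ccontr)
    assume "\<not> ?thesis"
    moreover have "mult u y > 0" using that by (simp add: mem_nbrs_iff)
    ultimately have "t + 1 \<le> deg u" using critical_deg[OF that] by linarith
    then show False using xu by simp
  qed
  have eq3: "nbrs y = {p, q, r}" if "{p, q, r} \<subseteq> nbrs y" "distinct [p, q, r]" "s \<le> deg y" for y p q r
    using card_subset_eq[OF finite_nbrs that(1)] card_nbrs_eq_3[OF that(3)] that(2) by simp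
  have xn: "x \<in> nbrs u" "x \<in> nbrs v" "x \<in> nbrs w" using nx nbrs_sym by blast+
  have nu: "nbrs u = {x, v, w}" using uvw xn bu dist by (intro eq3) auto
  have bv: "s \<le> deg v" and bw: "s \<le> deg w" using big uvw by auto
  have uv': "u \<in> nbrs v" "u \<in> nbrs w" using uvw nbrs_sym by blast+
  have "w \<in> nbrs v"
  proof -
    obtain p q r where pqr: "nbrs v = {p, q, r}" "distinct [p, q, r]"
      "s + t \<le> mult p q + deg v" "s + t \<le> mult p r + deg v"
      by (rule two_heavy_pairs[OF bv card_nbrs_eq_3[OF bv]])
    have h: "q \<in> nbrs p" "r \<in> nbrs p" using pqr(3,4) deg_le[of v] s4 by (auto simp: mem_nbrs_iff)
    then have h': "p \<in> nbrs q" "p \<in> nbrs r" using nbrs_sym by blast+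
    \<comment> \<open>Of the three neighbours of \<open>v\<close>, the centre \<open>p\<close> of
      the heavy pairs is adjacent to the other two. Whether or not \<open>p\<close> is
      \<open>x\<close> or \<open>u\<close>, the neighbour other than these is adjacent to one of
      them, hence it is \<open>w\<close>.\<close>
    obtain z where z: "z \<in> nbrs v" "z \<noteq> x" "z \<noteq> u" "z \<in> nbrs x \<or> z \<in> nbrs u"
    proof -
      have "x \<in> {p, q, r}" "u \<in> {p, q, r}" "x \<noteq> u" using xn(2) uv'(1) pqr(1) dist by auto
      then show thesis using that[of p] that[of q] that[of r] h h' pqr(1,2) by auto
    qed
    then have "z = w" using nx nu not_self_nbr by auto
    then show ?thesis using z by simp
  qed
  then have nv: "nbrs v = {x, u, w}" and nw: "nbrs w = {x, u, v}"
    using eq3[of x u w v] eq3[of x u v w] xn uv' bv bw dist nbrs_sym[of v w] by auto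
  let ?F = "{e \<in> E. en e \<subseteq> {x, u, v, w}}"
  have closed: "en f \<subseteq> {x, u, v, w}" if f: "f \<in> E" "p \<in> en f" "p \<in> {x, u, v, w}" for f p
  proof -
    obtain q where q: "en f = {p, q}" using en_cases[OF f(1,2)] by blast
    then have "q \<in> nbrs p" using f(1) by (auto simp: nbrs_def link_def)
    then show ?thesis using q f(3) nx nu nv nw by auto
  qed
  obtain g where g: "g \<in> ?F"
    using xn(1) dist by (auto simp: nbrs_def link_def)
  \<comment> \<open>The component contains an edge \<open>g\<close>, so criticality colours
    everything outside it.\<close>
  have "edge_colourable en (E - ?F) (s + t - 2)"
    by (rule edge_colourable_mono[OF critical[of g]]) (use g in auto)
  moreover have "edge_colourable en ?F (s + t - 2)"
    using four_vertices_colourable[OF dist] .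
  ultimately have "edge_colourable en (?F \<union> (E - ?F)) (s + t - 2)"
    by (intro edge_colourable_disjoint_Un) (use closed in blast)+
  moreover have "?F \<union> (E - ?F) = E" by blast
  ultimately show False using not_colourable by simp
qed

end

section \<open>Translation to line graphs\<close>

lemma line_graph_simps:
  "fst (line_graph G) = edges G"
  "{e, f} \<in> snd (line_graph G) \<longleftrightarrow>
     e \<in> edges G \<and> f \<in> edges G \<and> e \<noteq> f \<and> ends G e \<inter> ends G f \<noteq> {}"
  unfolding line_graph_def by (auto simp: doubleton_eq_iff Int_commute)

lemma proper_colouring_line_graph_iff:
  "proper_colouring (line_graph G) n c \<longleftrightarrow> edge_colouring (ends G) (edges G) n c"
  unfolding proper_colouring_def edge_colouring_def line_graph_simps by blast

lemma proper_colouring_delete_iff: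
  "proper_colouring (delete_vertices (line_graph G) Q) n c \<longleftrightarrow>
     edge_colouring (ends G) (edges G - Q) n c"
proof -
  have V: "fst (delete_vertices (line_graph G) Q) = edges G - Q"
    by (simp add: delete_vertices_def line_graph_simps)
  have A: "{e, f} \<in> snd (delete_vertices (line_graph G) Q) \<longleftrightarrow>
      e \<noteq> f \<and> ends G e \<inter> ends G f \<noteq> {}" if "e \<in> edges G - Q" "f \<in> edges G - Q" for e f
    using that by (simp add: delete_vertices_def line_graph_simps)
  show ?thesis
    unfolding proper_colouring_def edge_colouring_def V using A by meson
qed

lemma is_clique_line_graph_iff:
  "is_clique (line_graph G) Q \<longleftrightarrow> Q \<subseteq> edges G \<and> intersecting (ends G) Q"
  unfolding is_clique_def intersecting_def clique_def line_graph_simps by blast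

lemma card_le_clique_number:
  assumes "finite (fst H)" "is_clique H Q"
  shows "card Q \<le> clique_number H"
proof -
  have "{card Q | Q. is_clique H Q} \<subseteq> card ` Pow (fst H)" by (auto simp: is_clique_def)
  then have "finite {card Q | Q. is_clique H Q}"
    using assms(1) by (meson finite_Pow_iff finite_imageI finite_subset)
  then show ?thesis unfolding clique_number_def using assms(2) by (intro Max_ge) auto
qed

theorem theorem2:
  fixes s t :: nat
    and G :: "('v, 'e) multigraph"
  assumes "4 \<le> s" and "s \<le> t"
    and "is_multigraph G"
    and "chromatic_number (line_graph G) = s + t - 1"
    and "s + t - 1 > clique_number (line_graph G)"
  shows "\<exists>Q. is_clique (line_graph G) Q \<and> card Q = s \<and>
           chromatic_number (delete_vertices (line_graph G) Q) \<ge> t + 1"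
proof (rule ccontr)
  assume neg: "\<not> ?thesis"
  let ?en = "ends G"
  have fin: "finite (edges G)" and card_en: "\<And>e. e \<in> edges G \<Longrightarrow> card (?en e) = 2"
    using assms(3) by (auto simp: is_multigraph_def)
  have "\<not> (\<exists>c. proper_colouring (line_graph G) (s + t - 2) c)"
    using not_less_Least[of "s + t - 2" "\<lambda>k. \<exists>c. proper_colouring (line_graph G) k c"] assms(1,4)
    unfolding chromatic_number_def by simp
  then have nc: "\<not> edge_colourable ?en (edges G) (s + t - 2)"
    by (simp add: edge_colourable_def proper_colouring_line_graph_iff)
  have removal: "edge_colourable ?en (edges G - Q) t"
    if Q: "Q \<subseteq> edges G" "intersecting ?en Q" "card Q = s" for Q
  proof -
    let ?n = "chromatic_number (delete_vertices (line_graph G) Q)"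
    \<comment> \<open>One colour per edge shows that some colouring exists, so the
      \<open>LEAST\<close> in \<open>chromatic_number\<close> is attained.\<close>
    have "edge_colourable ?en (edges G - Q) (card (edges G - Q))"
      using fin by (intro edge_colourable_card) simp
    then have "\<exists>c. proper_colouring (delete_vertices (line_graph G) Q) (card (edges G - Q)) c"
      by (simp add: proper_colouring_delete_iff edge_colourable_def)
    then have "\<exists>c. proper_colouring (delete_vertices (line_graph G) Q) ?n c"
      unfolding chromatic_number_def by (rule LeastI)
    then have "edge_colourable ?en (edges G - Q) ?n"
      by (simp add: proper_colouring_delete_iff edge_colourable_def)
    moreover have "?n \<le> t" using neg Q is_clique_line_graph_iff by (metis not_less_eq_eq Suc_eq_plus1)
    ultimately show ?thesis using edge_colourable_mono by blast
  qed
  let ?P = "\<lambda>F. F \<subseteq> edges G \<and> \<not> edge_colourable ?en F (s + t - 2)"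
  \<comment> \<open>Minimal cardinality yields criticality; the clique and removal conditions pass
    from \<open>edges G\<close> to \<open>E\<close>.\<close>
  obtain E where E: "?P E" and min: "\<And>F. ?P F \<Longrightarrow> card E \<le> card F"
    using nc ex_has_least_nat[of ?P "edges G" card] by blast
  have finE: "finite E" using E fin finite_subset by blast
  have "critical_family E ?en s t"
  proof
    show "edge_colourable ?en (E - {e}) (s + t - 2)" if "e \<in> E" for e
      using min[of "E - {e}"] E that card_Diff1_less[OF finE that] by force
    show "card Q \<le> s + t - 2" if "Q \<subseteq> E" "intersecting ?en Q" for Q
    proof -
      have "is_clique (line_graph G) Q" using that E by (auto simp: is_clique_line_graph_iff)
      moreover have "finite (fst (line_graph G))" using fin by (simp add: line_graph_def)
      ultimately have "card Q \<le> clique_number (line_graph G)" by (intro card_le_clique_number)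
      then show ?thesis using assms(5) by linarith
    qed
    show "edge_colourable ?en (E - Q) t" if "Q \<subseteq> E" "intersecting ?en Q" "card Q = s" for Q
      by (rule edge_colourable_mono[OF removal[of Q]]) (use that E in auto)
  qed (use finE E card_en assms in auto)
  then show False by (rule critical_family.inconsistent)
qed

end
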